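(* There exists an absolute constant $C>0$ such that the following holds. Let $k,t$ be positive integers with $t>k$, let $n$ be an integer with $n>Ct^{3k+3}$, and let $\{w_X\}_{X\in\binom{[n]}{k}}$ be an assignment of real weights to the $k$-element subsets of $[n]$ with $\sum_{X\in\binom{[n]}{k}} w_X\ge 0$. Then there are at least $\binom{n-k}{t-k}$ subsets $T\subset[n]$ of size $t$ such that $\sum_{X\subset T,\,|X|=k} w_X\ge 0$.
   Context: $[n]=\{1,\dots,n\}$, and $\binom{[n]}{k}$ denotes the family of all $k$-element subsets of $[n]$. *)

theory Defs
  imports Complex_Main "HOL-Library.Ramsey"
begin

end

(*
  Write f(T) for the sum of the weights of the k-subsets of a t-set T, m = C(t,k) and D = C(n-k,t-k).
  The map from w to f has an explicit inverse with small entries, which gives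
  D * sum |w| <= 2^k m * sum |f|; if the total weight is nonnegative, sum |f| is at most twice the
  sum of the positive parts of f.

  Suppose fewer than D sets T have f(T) >= 0, and let X0 have maximal weight. Since f <= m w(X0), the
  inequality bounds sum |w| by 2^(k+1) m^2 w(X0), so the weights other than w(X0) are negligible for
  most T containing X0: all but a fraction of order 1/n of these D sets have f(T) >= 0, and hence
  only few other sets do. Some T0 containing X0 has f(T0) < 0. Deleting the weights inside T0 leaves
  a weighting w' with positive total for which nonnegative sums are so rare that the same inequality
  yields sum |w'| < sum |w'|.
*)
theory Submission
  imports Defs
begin

section \<open>Inverting the map from weights to sums over \<open>t\<close>-sets\<close>

text \<open>Complementation in \<open>W\<close> turns \<open>T\<close> into a subset of
  \<open>W - Z\<close>. The lower index \<open>card W - t\<close> makes the binomial vanish when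
  \<open>card Z > t\<close>, where \<open>t - card Z\<close> would be truncated.\<close>

lemma card_nsets_superset:
  assumes "finite W" "Z \<subseteq> W" "t \<le> card W"
  shows "card {T \<in> nsets W t. Z \<subseteq> T} = (card W - card Z) choose (card W - t)"
proof -
  have "bij_betw (\<lambda>T. W - T) {T \<in> nsets W t. Z \<subseteq> T} {B. B \<subseteq> W - Z \<and> card B = card W - t}"
  proof (rule bij_betwI[where g = "\<lambda>T. W - T"])
    show "(\<lambda>T. W - T) \<in> {T \<in> nsets W t. Z \<subseteq> T} \<rightarrow> {B. B \<subseteq> W - Z \<and> card B = card W - t}"
      by (auto simp: nsets_def card_Diff_subset)
    show "(\<lambda>T. W - T) \<in> {B. B \<subseteq> W - Z \<and> card B = card W - t} \<rightarrow> {T \<in> nsets W t. Z \<subseteq> T}"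
    proof (intro funcsetI CollectI)
      fix B assume "B \<in> {B. B \<subseteq> W - Z \<and> card B = card W - t}"
      then have B: "B \<subseteq> W - Z" "card B = card W - t" by auto
      then have "B \<subseteq> W" by blast
      then have "card (W - B) = t"
        using B assms by (simp add: card_Diff_subset finite_subset)
      then show "W - B \<in> nsets W t \<and> Z \<subseteq> W - B"
        using B assms by (auto simp: nsets_def)
    qed
  qed (auto simp: nsets_def)
  then have "card {T \<in> nsets W t. Z \<subseteq> T} = card {B. B \<subseteq> W - Z \<and> card B = card W - t}"
    by (rule bij_betw_same_card)
  also have "\<dots> = (card W - card Z) choose (card W - t)"
    using assms by (simp add: n_subsets card_Diff_subset finite_subset)
  finally show ?thesis .
qed

text \<open>This is the \<open>card S\<close>-th finite difference of the polynomial "x choose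
  \<open>r\<close>", whose degree is below \<open>card S\<close>. Pairing \<open>A\<close> with
  \<open>insert x A\<close> takes one difference, and Pascal's rule lowers \<open>r\<close> by one.
  The bound \<open>card S \<le> q\<close> keeps \<open>q - card A\<close> from being
  truncated.\<close>

lemma alternating_sum_binomial:
  assumes "finite S" "r < card S" "card S \<le> q"
  shows "(\<Sum>A\<in>Pow S. (-1) ^ card A * real ((q - card A) choose r)) = 0"
  using assms
proof (induction S arbitrary: q r rule: finite_induct)
  case empty
  then show ?case by simp
next
  case (insert x S)
  have inj: "inj_on (insert x) (Pow S)"
    using insert.hyps by (auto simp: inj_on_def)
  have "(\<Sum>A\<in>Pow (insert x S). (-1) ^ card A * real ((q - card A) choose r))
      = (\<Sum>A\<in>Pow S. (-1) ^ card A * real ((q - card A) choose r))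
      + (\<Sum>A\<in>Pow S. (-1) ^ card (insert x A) * real ((q - card (insert x A)) choose r))"
    unfolding Pow_insert
    by (subst sum.union_disjoint)
      (use insert.hyps inj in \<open>auto simp: sum.reindex\<close>)
  also have "\<dots> = (\<Sum>A\<in>Pow S. (-1) ^ card A *
      (real ((q - card A) choose r) - real ((q - 1 - card A) choose r)))"
    unfolding sum.distrib[symmetric]
  proof (rule sum.cong)
    fix A assume "A \<in> Pow S"
    then have "card (insert x A) = Suc (card A)"
      using insert.hyps by (subst card_insert_disjoint) (auto simp: finite_subset)
    then show "(-1) ^ card A * real ((q - card A) choose r)
        + (-1) ^ card (insert x A) * real ((q - card (insert x A)) choose r)
      = (-1) ^ card A * (real ((q - card A) choose r) - real ((q - 1 - card A) choose r))"
      by (simp add: algebra_simps)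
  qed simp
  also have "\<dots> = 0"
  proof (cases r)
    case 0
    then show ?thesis by simp
  next
    case (Suc r')
    have "(\<Sum>A\<in>Pow S. (-1) ^ card A *
        (real ((q - card A) choose r) - real ((q - 1 - card A) choose r)))
      = (\<Sum>A\<in>Pow S. (-1) ^ card A * real ((q - 1 - card A) choose r'))"
    proof (rule sum.cong)
      fix A assume "A \<in> Pow S"
      then have "card A \<le> card S" using insert.hyps by (simp add: card_mono)
      then have "q - card A = Suc (q - 1 - card A)"
        using insert.prems insert.hyps by simp
      then show "(-1) ^ card A * (real ((q - card A) choose r) - real ((q - 1 - card A) choose r))
        = (-1) ^ card A * real ((q - 1 - card A) choose r')"
        by (simp only: Suc binomial_Suc_Suc) simp
    qed simp
    also have "\<dots> = 0"
      using insert.prems insert.hyps Suc by (intro insert.IH) auto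
    finally show ?thesis .
  qed
  finally show ?case .
qed

text \<open>With \<open>f T\<close> the sum of the weights of the \<open>k\<close>-subsets of \<open>T\<close>, these are the coefficients of
  \<open>f T\<close>, for \<open>card (T \<inter> X) = j\<close>, in the inversion formula for \<open>w X\<close>. They are chosen so that the
  vanishing coefficient of \<open>w Y\<close> for \<open>Y \<noteq> X\<close>, \<open>s = card (X - Y)\<close>, becomes the \<open>s\<close>-th finite
  difference of a polynomial of degree \<open>s - 1\<close>.\<close>

definition inv_coeff :: "nat \<Rightarrow> nat \<Rightarrow> nat \<Rightarrow> nat \<Rightarrow> real"
  where "inv_coeff n k t j =
    (-1) ^ (k + j) * real (t - k) / (real (t - j) * real ((n - k) choose (t - j)))"

text \<open>Trinomial revision with a complemented lower index, so that for \<open>s > u\<close>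
  both sides vanish and no case distinction is needed later.\<close>

lemma choose_diff_mult:
  assumes "u \<le> M" "s \<le> M"
  shows "((M - s) choose (M - u)) * (M choose s) = (M choose u) * (u choose s)"
proof (cases "s \<le> u")
  case True
  then have "(M - s) choose (M - u) = (M - s) choose (u - s)"
    using assms by (subst binomial_symmetric) auto
  then show ?thesis
    using choose_mult[of s u M] True assms by simp
next
  case False
  then have "M - s < M - u" using assms by simp
  then show ?thesis using False by (simp add: binomial_eq_0)
qed

text \<open>The coefficient depends on \<open>T\<close> only through
  \<open>A = T \<inter> X\<close>, so the sum is grouped by \<open>A\<close>. Since
  \<open>Y \<subseteq> T\<close>, such an \<open>A\<close> consists of \<open>X \<inter> Y\<close>
  and an arbitrary subset of \<open>X - Y\<close>; the signs then form a finite difference over the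
  subsets of \<open>X - Y\<close>.\<close>

lemma sum_inv_coeff:
  assumes V: "finite V" "card V = n" and X: "X \<in> nsets V k" and Y: "Y \<in> nsets V k"
    and k: "k < t" and n: "t + k \<le> n"
  shows "(\<Sum>T\<in>{T \<in> nsets V t. Y \<subseteq> T}. inv_coeff n k t (card (T \<inter> X))) = (if X = Y then 1 else 0)"
proof -
  define s where "s = card (X - Y)"
  have fX: "finite X" "X \<subseteq> V" "card X = k" and fY: "finite Y" "Y \<subseteq> V" "card Y = k"
    using X Y by (auto simp: nsets_def)
  have s': "card (Y - X) = s"
    unfolding s_def using fX fY card_le_sym_Diff
    by (metis card_Diff_subset_Int finite_Int inf_commute)
  have sk: "s \<le> k" unfolding s_def using fX by (metis card_mono Diff_subset)
  have kn: "k \<le> n" using n by simp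
  define i where "i = card (X \<inter> Y)"
  have ik: "i + s = k"
    unfolding i_def s_def using fX card_Int_Diff[of X Y] by simp
  have cnt: "card {T \<in> {T \<in> nsets V t. Y \<subseteq> T}. T \<inter> X = A}
      = (if X \<inter> Y \<subseteq> A then (n - k - s) choose (n - k - (t - card A)) else 0)"
    if A: "A \<subseteq> X" for A
  proof (cases "X \<inter> Y \<subseteq> A")
    case True
    have Ak: "card A \<le> k" using A fX card_mono by metis
    \<comment> \<open>Prescribing the trace \<open>A\<close> on \<open>X\<close> means staying
      inside \<open>V - X \<union> A\<close> and containing \<open>A\<close>, which reduces the
      count to supersets of \<open>A \<union> Y\<close>.\<close>
    have "{T \<in> {T \<in> nsets V t. Y \<subseteq> T}. T \<inter> X = A} = {T \<in> nsets (V - X \<union> A) t. A \<union> Y \<subseteq> T}"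
      using A fX True by (auto simp: nsets_def)
    moreover have "card (V - X \<union> A) = n - k + card A"
      using A fX V by (subst card_Un_disjoint) (auto simp: card_Diff_subset finite_subset)
    moreover have "card (A \<union> Y) = card A + s"
    proof -
      have "A \<union> Y = A \<union> (Y - X)" using True A by blast
      moreover have "A \<inter> (Y - X) = {}" using A by blast
      ultimately show ?thesis
        using s' A fX fY by (simp add: card_Un_disjoint finite_subset)
    qed
    moreover have "A \<union> Y \<subseteq> V - X \<union> A" using True A fX fY by blast
    moreover have "finite (V - X \<union> A)" using A fX V by (auto simp: finite_subset)
    ultimately have "card {T \<in> {T \<in> nsets V t. Y \<subseteq> T}. T \<inter> X = A}
        = (n - k + card A - (card A + s)) choose (n - k + card A - t)"
      using n k card_nsets_superset[of "V - X \<union> A" "A \<union> Y" t] by simp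
    moreover have "n - k + card A - t = n - k - (t - card A)" using Ak k n by linarith
    ultimately show ?thesis using True by simp
  next
    case False
    then have "{T \<in> {T \<in> nsets V t. Y \<subseteq> T}. T \<inter> X = A} = {}" by blast
    then show ?thesis using False by (simp only: card.empty if_False)
  qed
  have "(\<Sum>T\<in>{T \<in> nsets V t. Y \<subseteq> T}. inv_coeff n k t (card (T \<inter> X)))
      = (\<Sum>A\<in>Pow X. \<Sum>T\<in>{T \<in> {T \<in> nsets V t. Y \<subseteq> T}. T \<inter> X = A}. inv_coeff n k t (card (T \<inter> X)))"
    using fX V by (intro sum.group[symmetric]) (auto simp: finite_imp_finite_nsets)
  also have "\<dots> = (\<Sum>A\<in>Pow X. inv_coeff n k t (card A) *
      real (if X \<inter> Y \<subseteq> A then (n - k - s) choose (n - k - (t - card A)) else 0))"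
    using cnt by (intro sum.cong) (simp_all add: mult.commute)
  also have "\<dots> = (\<Sum>A\<in>{A. X \<inter> Y \<subseteq> A \<and> A \<subseteq> X}. inv_coeff n k t (card A) *
      real ((n - k - s) choose (n - k - (t - card A))))"
    using fX by (intro sum.mono_neutral_cong_right) auto
  also have "\<dots> = (\<Sum>A\<in>Pow (X - Y). inv_coeff n k t (i + card A) *
      real ((n - k - s) choose (n - k - (t - (i + card A)))))"
  proof (rule sum.reindex_bij_witness[where i = "\<lambda>A. (X \<inter> Y) \<union> A" and j = "\<lambda>A. A - Y"], goal_cases)
    case (5 A)
    then have "A = (X \<inter> Y) \<union> (A - Y)" "(X \<inter> Y) \<inter> (A - Y) = {}" by auto
    then have "card A = i + card (A - Y)"
      unfolding i_def using fX 5 by (metis card_Un_disjoint finite_Un finite_subset mem_Collect_eq)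
    then show ?case by simp
  qed auto
  also have "\<dots> = (if X = Y then 1 else 0)"
  proof (cases s)
    case 0
    then have "X - Y = {}" using fX by (simp add: s_def)
    then have "X = Y" using fX fY by (metis Diff_eq_empty_iff card_subset_eq)
    moreover have "n - k - (t - k) = n - t" using k n by simp
    moreover have "(n - k) choose (n - t) = (n - k) choose (t - k)"
      using k n by (subst binomial_symmetric) auto
    moreover have "(n - k) choose (t - k) > 0" using k n by (simp add: zero_less_binomial)
    ultimately show ?thesis using 0 ik k by (simp add: inv_coeff_def flip: mult_2 power_mult)
  next
    case (Suc r)
    have "X \<noteq> Y" using Suc by (auto simp: s_def)
    \<comment> \<open>With \<open>u = t - card (T \<inter> X)\<close>, the quotient of the two
      binomials is (\<open>u\<close> choose \<open>s\<close>) / (\<open>n - k\<close> choose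
      \<open>s\<close>). The extra factor \<open>u\<close> in the denominator of the coefficient is
      then absorbed, leaving (\<open>u - 1\<close> choose \<open>s - 1\<close>) / \<open>s\<close>,
      of degree one less than the order \<open>s\<close> of the difference.\<close>
    have "inv_coeff n k t (i + card A) * real ((n - k - s) choose (n - k - (t - (i + card A))))
       = (-1) ^ (k + i) * real (t - k) / (real s * real ((n - k) choose s)) *
         ((-1) ^ card A * real ((t - i - 1 - card A) choose r))" if "A \<in> Pow (X - Y)" for A
    proof -
      define u where "u = t - (i + card A)"
      have "card A \<le> s" unfolding s_def using that fX by (auto intro: card_mono)
      then have u: "u > 0" "u \<le> n - k" "t - i - 1 - card A = u - 1" "s \<le> n - k"
        using ik k n by (auto simp: u_def)
      have 1: "((n - k - s) choose (n - k - u)) * ((n - k) choose s) = ((n - k) choose u) * (u choose s)"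
        using u by (intro choose_diff_mult) auto
      have 2: "s * (u choose s) = u * ((u - 1) choose r)"
        unfolding Suc by (rule binomial_absorption)
      have 3: "(n - k) choose s > 0" "(n - k) choose u > 0" "s > 0"
        using u Suc by (auto simp: zero_less_binomial)
      have "real ((n - k - s) choose (n - k - u))
          = real ((n - k) choose u) * real u * real ((u - 1) choose r) / (real s * real ((n - k) choose s))"
        using 1 2 3 by (simp add: field_simps flip: of_nat_mult)
      then show ?thesis
        unfolding inv_coeff_def u_def[symmetric] u(3) using 3 u(1)
        by (simp add: power_add)
    qed
    then have "(\<Sum>A\<in>Pow (X - Y). inv_coeff n k t (i + card A) *
        real ((n - k - s) choose (n - k - (t - (i + card A)))))
      = (-1) ^ (k + i) * real (t - k) / (real s * real ((n - k) choose s)) *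
        (\<Sum>A\<in>Pow (X - Y). (-1) ^ card A * real ((t - i - 1 - card A) choose r))"
      unfolding sum_distrib_left by (rule sum.cong[OF refl])
    \<comment> \<open>Here \<open>i + s = k < t\<close> gives \<open>s \<le> t - i - 1\<close>, so
      no argument is truncated.\<close>
    also have "(\<Sum>A\<in>Pow (X - Y). (-1) ^ card A * real ((t - i - 1 - card A) choose r)) = 0"
      using fX Suc ik k by (intro alternating_sum_binomial) (auto simp: s_def)
    finally show ?thesis using \<open>X \<noteq> Y\<close> by simp
  qed
  finally show ?thesis .
qed

lemma nsets_subset_eq: "T \<subseteq> V \<Longrightarrow> nsets T k = {X \<in> nsets V k. X \<subseteq> T}"
  by (auto simp: nsets_def)

lemma sum_nsets_swap:
  assumes "finite V"
  shows "(\<Sum>T\<in>nsets V t. \<Sum>X\<in>nsets T k. g X T)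
       = (\<Sum>X\<in>nsets V k. \<Sum>T\<in>{T \<in> nsets V t. X \<subseteq> T}. g X T)"
proof -
  have "(\<Sum>T\<in>nsets V t. \<Sum>X\<in>nsets T k. g X T)
      = (\<Sum>T\<in>nsets V t. \<Sum>X\<in>{X \<in> nsets V k. X \<subseteq> T}. g X T)"
    by (intro sum.cong refl nsets_subset_eq) (auto simp: nsets_def)
  also have "\<dots> = (\<Sum>X\<in>nsets V k. \<Sum>T\<in>{T \<in> nsets V t. X \<subseteq> T}. g X T)"
    using assms by (intro sum.swap_restrict finite_imp_finite_nsets)
  finally show ?thesis .
qed

lemma weight_inversion:
  assumes "finite V" "card V = n" "X \<in> nsets V k" "k < t" "t + k \<le> n"
  shows "w X = (\<Sum>T\<in>nsets V t. inv_coeff n k t (card (T \<inter> X)) * (\<Sum>Y\<in>nsets T k. w Y))"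
proof -
  have "(\<Sum>T\<in>nsets V t. inv_coeff n k t (card (T \<inter> X)) * (\<Sum>Y\<in>nsets T k. w Y))
      = (\<Sum>T\<in>nsets V t. \<Sum>Y\<in>nsets T k. inv_coeff n k t (card (T \<inter> X)) * w Y)"
    by (simp add: sum_distrib_left)
  also have "\<dots> = (\<Sum>Y\<in>nsets V k. \<Sum>T\<in>{T \<in> nsets V t. Y \<subseteq> T}. inv_coeff n k t (card (T \<inter> X)) * w Y)"
    using assms by (intro sum_nsets_swap)
  also have "\<dots> = (\<Sum>Y\<in>nsets V k. (if X = Y then w Y else 0))"
    using assms by (intro sum.cong) (simp_all add: sum_inv_coeff flip: sum_distrib_right)
  also have "\<dots> = w X"
    using assms by (simp add: finite_imp_finite_nsets)
  finally show ?thesis ..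
qed

section \<open>The absolute sum of the weights bounded by the sums over
  \<open>t\<close>-sets\<close>

lemma card_nsets_Int:
  assumes "finite V" "T \<subseteq> V" "j \<le> k"
  shows "card {X \<in> nsets V k. card (T \<inter> X) = j} = (card T choose j) * ((card V - card T) choose (k - j))"
proof -
  let ?P = "{A. A \<subseteq> T \<and> card A = j} \<times> {B. B \<subseteq> V - T \<and> card B = k - j}"
  have fT: "finite T" using assms finite_subset by blast
  have "bij_betw (\<lambda>X. (T \<inter> X, X - T)) {X \<in> nsets V k. card (T \<inter> X) = j} ?P"
  proof (rule bij_betwI[where g = "\<lambda>(A, B). A \<union> B"])
    show "(\<lambda>X. (T \<inter> X, X - T)) \<in> {X \<in> nsets V k. card (T \<inter> X) = j} \<rightarrow> ?P"
      by (auto simp: nsets_def card_Diff_subset_Int Int_commute)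
    show "(\<lambda>(A, B). A \<union> B) \<in> ?P \<rightarrow> {X \<in> nsets V k. card (T \<inter> X) = j}"
    proof clarify
      fix A B assume A: "A \<subseteq> T" and B: "B \<subseteq> V - T" "card B = k - card A" and j: "j = card A"
      have "finite A" "finite B" "A \<inter> B = {}" "T \<inter> (A \<union> B) = A"
        using A B assms fT by (auto simp: finite_subset)
      then show "A \<union> B \<in> nsets V k \<and> card (T \<inter> (A \<union> B)) = card A"
        using A B j assms by (auto simp: nsets_def card_Un_disjoint)
    qed
  qed auto
  then have "card {X \<in> nsets V k. card (T \<inter> X) = j} = card ?P"
    by (rule bij_betw_same_card)
  then show ?thesis
    using assms fT by (simp add: card_cartesian_product n_subsets card_Diff_subset)
qed

text \<open>Both sides count ordered pairs of disjoint sets of sizes \<open>a\<close> and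
  \<open>b\<close> in an \<open>N\<close>-set.\<close>

lemma choose_mult_swap:
  assumes "a + b \<le> N"
  shows "(N choose a) * ((N - a) choose b) = (N choose b) * ((N - b) choose a)"
proof -
  have "(a + b) choose a = (a + b) choose b" by (subst binomial_symmetric) auto
  then show ?thesis
    using choose_mult[of a "a + b" N] choose_mult[of b "a + b" N] assms by simp
qed

text \<open>Both sides count pairs of a \<open>t\<close>-set and a \<open>k\<close>-set meeting in
  \<open>j\<close> points, choosing first the \<open>t\<close>-set or first the
  \<open>k\<close>-set.\<close>

lemma choose_mult_choose_mult:
  assumes "j \<le> k" "j \<le> t" "t + k \<le> n"
  shows "(n choose t) * (t choose j) * ((n - t) choose (k - j))
       = (n choose k) * (k choose j) * ((n - k) choose (t - j))"
proof -
  have "(n choose t) * (t choose j) = (n choose j) * ((n - j) choose (t - j))"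
    "(n choose k) * (k choose j) = (n choose j) * ((n - j) choose (k - j))"
    using assms by (auto intro: choose_mult)
  moreover have "((n - j) choose (t - j)) * ((n - t) choose (k - j))
      = ((n - j) choose (k - j)) * ((n - k) choose (t - j))"
    using choose_mult_swap[of "t - j" "k - j" "n - j"] assms by simp
  ultimately show ?thesis by (simp add: mult.assoc)
qed

text \<open>Group by \<open>j = card (T \<inter> X)\<close>. As (\<open>t - k\<close>) /
  (\<open>t - j\<close>) is at most 1, the double count bounds the contribution of \<open>j\<close>
  by (\<open>t\<close> choose \<open>k\<close>)(\<open>k\<close> choose \<open>j\<close>), and the
  row sum of the binomials gives the power of two.\<close>

lemma sum_abs_inv_coeff_le:
  assumes V: "finite V" "card V = n" and T: "T \<in> nsets V t" and k: "k < t" "t + k \<le> n"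
  shows "real ((n - k) choose (t - k)) * (\<Sum>X\<in>nsets V k. \<bar>inv_coeff n k t (card (T \<inter> X))\<bar>)
       \<le> 2 ^ k * real (t choose k)"
proof -
  let ?D = "real ((n - k) choose (t - k))"
  have T': "finite T" "T \<subseteq> V" "card T = t" using T by (auto simp: nsets_def)
  have le: "card (T \<inter> X) \<le> k" if "X \<in> nsets V k" for X
    using that card_mono[of X "T \<inter> X"] by (auto simp: nsets_def)
  have "?D * (\<Sum>X\<in>nsets V k. \<bar>inv_coeff n k t (card (T \<inter> X))\<bar>)
      = ?D * (\<Sum>j\<le>k. \<Sum>X\<in>{X \<in> nsets V k. card (T \<inter> X) = j}. \<bar>inv_coeff n k t (card (T \<inter> X))\<bar>)"
    using V le by (subst sum.group) (auto simp: finite_imp_finite_nsets)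
  also have "\<dots> = ?D * (\<Sum>j\<le>k. real ((t choose j) * ((n - t) choose (k - j))) * \<bar>inv_coeff n k t j\<bar>)"
    using V T' by (simp add: card_nsets_Int)
  also have "\<dots> = (\<Sum>j\<le>k. ?D * real ((t choose j) * ((n - t) choose (k - j))) * \<bar>inv_coeff n k t j\<bar>)"
    by (simp add: sum_distrib_left mult.assoc)
  also have "\<dots> \<le> (\<Sum>j\<le>k. real (t choose k) * real (k choose j))"
  proof (rule sum_mono)
    fix j assume "j \<in> {..k}"
    then have j: "j \<le> k" by simp
    have pos: "(n - k) choose (t - j) > 0" "n choose t > 0"
      using j k by (auto simp: zero_less_binomial)
    \<comment> \<open>The factor \<open>n choose t\<close> is introduced only to apply the double
      count, and is cancelled afterwards.\<close>
    have "(n choose t) * (((n - k) choose (t - k)) * ((t choose j) * ((n - t) choose (k - j))))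
        = ((n choose t) * (t choose j) * ((n - t) choose (k - j))) * ((n - k) choose (t - k))"
      by (simp only: mult_ac)
    also have "\<dots> = ((n choose k) * ((n - k) choose (t - k))) * ((k choose j) * ((n - k) choose (t - j)))"
      unfolding choose_mult_choose_mult[OF j less_imp_le[OF le_less_trans[OF j k(1)]] k(2)]
      by (simp only: mult_ac)
    also have "\<dots> = ((n choose t) * (t choose k)) * ((k choose j) * ((n - k) choose (t - j)))"
      using k by (subst choose_mult) auto
    finally have "(n choose t) * (((n - k) choose (t - k)) * ((t choose j) * ((n - t) choose (k - j))))
        = (n choose t) * ((t choose k) * (k choose j) * ((n - k) choose (t - j)))"
      by (simp only: mult_ac)
    then have "((n - k) choose (t - k)) * ((t choose j) * ((n - t) choose (k - j)))
        = (t choose k) * (k choose j) * ((n - k) choose (t - j))"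
      using pos by simp
    then have eq: "?D * real ((t choose j) * ((n - t) choose (k - j)))
        = real (t choose k) * real (k choose j) * real ((n - k) choose (t - j))"
      by (metis of_nat_mult)
    have "real (t - k) / real (t - j) \<le> 1" using j k by simp
    then have "\<bar>inv_coeff n k t j\<bar> * real ((n - k) choose (t - j)) \<le> 1"
      using pos by (simp add: inv_coeff_def abs_mult)
    then show "?D * real ((t choose j) * ((n - t) choose (k - j))) * \<bar>inv_coeff n k t j\<bar>
        \<le> real (t choose k) * real (k choose j)"
      unfolding eq
      using mult_left_mono[of "\<bar>inv_coeff n k t j\<bar> * real ((n - k) choose (t - j))" 1
          "real (t choose k) * real (k choose j)"]
      by (simp add: mult_ac)
  qed
  also have "\<dots> = 2 ^ k * real (t choose k)"
    unfolding sum_distrib_left[symmetric] of_nat_sum[symmetric] choose_row_sum by simp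
  finally show ?thesis .
qed

text \<open>The triangle inequality in the inversion formula: the norm of the inverse map is
  controlled by its absolute column sums, one for each \<open>T\<close>.\<close>

lemma sum_abs_weight_le:
  assumes "finite V" "card V = n" "k < t" "t + k \<le> n"
  shows "real ((n - k) choose (t - k)) * (\<Sum>X\<in>nsets V k. \<bar>w X\<bar>)
       \<le> 2 ^ k * real (t choose k) * (\<Sum>T\<in>nsets V t. \<bar>\<Sum>X\<in>nsets T k. w X\<bar>)"
proof -
  let ?D = "real ((n - k) choose (t - k))" and ?f = "\<lambda>T. \<Sum>X\<in>nsets T k. w X"
  have "(\<Sum>X\<in>nsets V k. \<bar>w X\<bar>)
      \<le> (\<Sum>X\<in>nsets V k. \<Sum>T\<in>nsets V t. \<bar>inv_coeff n k t (card (T \<inter> X))\<bar> * \<bar>?f T\<bar>)"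
    using assms
    by (intro sum_mono, subst weight_inversion[of V n _ k t])
      (auto intro!: order_trans[OF sum_abs] simp: abs_mult)
  also have "\<dots> = (\<Sum>T\<in>nsets V t. (\<Sum>X\<in>nsets V k. \<bar>inv_coeff n k t (card (T \<inter> X))\<bar>) * \<bar>?f T\<bar>)"
    by (subst sum.swap) (simp add: sum_distrib_right)
  finally have "?D * (\<Sum>X\<in>nsets V k. \<bar>w X\<bar>)
      \<le> ?D * (\<Sum>T\<in>nsets V t. (\<Sum>X\<in>nsets V k. \<bar>inv_coeff n k t (card (T \<inter> X))\<bar>) * \<bar>?f T\<bar>)"
    by (intro mult_left_mono) auto
  also have "\<dots> = (\<Sum>T\<in>nsets V t. (?D * (\<Sum>X\<in>nsets V k. \<bar>inv_coeff n k t (card (T \<inter> X))\<bar>)) * \<bar>?f T\<bar>)"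
    by (subst sum_distrib_left) (simp only: mult.assoc)
  also have "\<dots> \<le> (\<Sum>T\<in>nsets V t. 2 ^ k * real (t choose k) * \<bar>?f T\<bar>)"
    using assms by (intro sum_mono mult_right_mono sum_abs_inv_coeff_le) auto
  finally show ?thesis by (simp add: sum_distrib_left)
qed

lemma card_nsets_containing:
  assumes "finite V" "card V = n" "X \<in> nsets V k" "k \<le> t" "t \<le> n"
  shows "card {T \<in> nsets V t. X \<subseteq> T} = (n - k) choose (t - k)"
proof -
  have "card {T \<in> nsets V t. X \<subseteq> T} = (n - k) choose (n - t)"
    using card_nsets_superset[of V X t] assms by (auto simp: nsets_def)
  also have "\<dots> = (n - k) choose (t - k)"
    using assms by (subst binomial_symmetric) auto
  finally show ?thesis .
qed

text \<open>Every weight is counted equally often, so the sums over \<open>t\<close>-sets have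
  nonnegative total and their negative parts weigh no more than their positive parts. This makes a
  scarcity of nonnegative sums usable.\<close>

lemma sum_abs_weight_le_pos:
  assumes "finite V" "card V = n" "k < t" "t + k \<le> n" and nonneg: "(\<Sum>X\<in>nsets V k. w X) \<ge> 0"
  shows "real ((n - k) choose (t - k)) * (\<Sum>X\<in>nsets V k. \<bar>w X\<bar>)
       \<le> 2 ^ (k + 1) * real (t choose k) * (\<Sum>T\<in>nsets V t. max 0 (\<Sum>X\<in>nsets T k. w X))"
proof -
  let ?f = "\<lambda>T. \<Sum>X\<in>nsets T k. w X"
  have "(\<Sum>T\<in>nsets V t. ?f T) = (\<Sum>X\<in>nsets V k. \<Sum>T\<in>{T \<in> nsets V t. X \<subseteq> T}. w X)"
    using assms by (intro sum_nsets_swap)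
  also have "\<dots> = real ((n - k) choose (t - k)) * (\<Sum>X\<in>nsets V k. w X)"
    using assms by (simp add: card_nsets_containing sum_distrib_left)
  finally have "(\<Sum>T\<in>nsets V t. ?f T) \<ge> 0" using nonneg by simp
  moreover have "(\<Sum>T\<in>nsets V t. \<bar>?f T\<bar>) = 2 * (\<Sum>T\<in>nsets V t. max 0 (?f T)) - (\<Sum>T\<in>nsets V t. ?f T)"
    unfolding sum_distrib_left sum_subtractf[symmetric] by (intro sum.cong) auto
  ultimately have "(\<Sum>T\<in>nsets V t. \<bar>?f T\<bar>) \<le> 2 * (\<Sum>T\<in>nsets V t. max 0 (?f T))" by simp
  then have "2 ^ k * real (t choose k) * (\<Sum>T\<in>nsets V t. \<bar>?f T\<bar>)
      \<le> 2 ^ k * real (t choose k) * (2 * (\<Sum>T\<in>nsets V t. max 0 (?f T)))"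
    by (intro mult_left_mono) auto
  then show ?thesis
    using sum_abs_weight_le[OF assms(1-4), of w] unfolding power_add power_one_right
    by (simp only: mult_ac)
qed

section \<open>The contradiction from too few nonnegative sums\<close>

lemma card_nsets_containing_insert:
  assumes "finite V" "card V = n" "X \<in> nsets V k" "x \<in> V - X" "k < t" "t \<le> n"
  shows "card {T \<in> nsets V t. X \<subseteq> T \<and> x \<in> T} = (n - Suc k) choose (t - Suc k)"
proof -
  have "insert x X \<in> nsets V (Suc k)"
    using assms by (auto simp: nsets_def)
  then have "card {T \<in> nsets V t. insert x X \<subseteq> T} = (n - Suc k) choose (t - Suc k)"
    using assms by (intro card_nsets_containing) auto
  then show ?thesis by (simp add: conj_commute)
qed

text \<open>The hypothesis on \<open>n\<close> negates the inequality
  \<open>n - k \<le> c * (K + t) * (t - k)\<close> to which the argument by contradiction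
  leads.\<close>

lemma card_nonneg_sums_ge:
  fixes w :: "'a set \<Rightarrow> real" and k t n :: nat
  defines "f \<equiv> \<lambda>T. \<Sum>X\<in>nsets T k. w X"
  assumes V: "finite V" "card V = n" and k: "k < t" "t + k \<le> n"
    and n: "real k + 2 ^ (k + 1) * real (t choose k) *
      (2 ^ (k + 1) * real (t choose k) ^ 2 + real t) * real (t - k) < real n"
    and nonneg: "f V \<ge> 0"
  shows "(n - k) choose (t - k) \<le> card {T \<in> nsets V t. f T \<ge> 0}"
proof (rule ccontr)
  define m where "m = t choose k"
  define D where "D = (n - k) choose (t - k)"
  define D1 where "D1 = (n - Suc k) choose (t - Suc k)"
  define c where "c = 2 ^ (k + 1) * real m"
  define K where "K = c * real m"
  define F where "F = {T \<in> nsets V t. f T \<ge> 0}"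
  assume "\<not> (n - k) choose (t - k) \<le> card {T \<in> nsets V t. f T \<ge> 0}"
  then have FD: "card F < D" by (simp add: F_def D_def)
  have fin[simp]: "finite (nsets V j)" for j using V by (simp add: finite_imp_finite_nsets)
  have D_pos: "D > 0" unfolding D_def using k by (simp add: zero_less_binomial)
  \<comment> \<open>Requiring one more point costs the factor (\<open>t - k\<close>) /
    (\<open>n - k\<close>); all smallness for large \<open>n\<close> comes from this ratio.\<close>
  have D1: "(n - k) * D1 = (t - k) * D"
    unfolding D_def D1_def using binomial_absorption[of "t - Suc k" "n - k"] k by (simp add: Suc_diff_Suc)
  have c0: "c \<ge> 0" by (simp add: c_def)
  have "nsets V k \<noteq> {}" using V k by (auto simp: nsets_eq_empty_iff)
  then have "Max (w ` nsets V k) \<in> w ` nsets V k" by (intro Max_in) auto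
  then obtain X0 where X0: "X0 \<in> nsets V k" and "Max (w ` nsets V k) = w X0" by blast
  then have max: "w X \<le> w X0" if "X \<in> nsets V k" for X
    using that by (metis Max_ge fin finite_imageI imageI)
  have sub: "nsets T k \<subseteq> nsets V k" if "T \<in> nsets V t" for T
    using that by (auto simp: nsets_def)
  have cardT: "card (nsets T k) = m" if "T \<in> nsets V t" for T
  proof -
    have "nsets T k = {X. X \<subseteq> T \<and> card X = k}" "finite T" "card T = t"
      using that by (auto simp: nsets_def finite_subset)
    then show ?thesis unfolding m_def by (simp add: n_subsets)
  qed
  \<comment> \<open>Otherwise the nonnegative total forces all weights to be 0, and the
    \<open>D\<close> sets containing \<open>X0\<close> all lie in \<open>F\<close>.\<close>
  have w0: "w X0 > 0"
  proof (rule ccontr)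
    assume "\<not> w X0 > 0"
    then have le: "w X \<le> 0" if "X \<in> nsets V k" for X using max[OF that] by simp
    then have "w X = 0" if "X \<in> nsets V k" for X
      using nonneg that sum_nonneg_eq_0_iff[of "nsets V k" "\<lambda>X. - w X"]
        sum_nonpos[of "nsets V k" w]
      unfolding f_def by (simp add: sum_negf)
    then have "f T = 0" if "T \<in> nsets V t" for T
      using sub[OF that] unfolding f_def by (intro sum.neutral) blast
    then have "{T \<in> nsets V t. X0 \<subseteq> T} \<subseteq> F" by (auto simp: F_def)
    then have "card {T \<in> nsets V t. X0 \<subseteq> T} \<le> card F" by (intro card_mono) (auto simp: F_def)
    then show False using card_nsets_containing[of V n X0 k t] V X0 k FD by (simp add: D_def)
  qed
  have l1: "(\<Sum>X\<in>nsets V k. \<bar>w X\<bar>) \<le> K * w X0"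
  proof -
    have "real D * (\<Sum>X\<in>nsets V k. \<bar>w X\<bar>) \<le> c * (\<Sum>T\<in>nsets V t. max 0 (f T))"
      unfolding D_def c_def m_def f_def
      using V k nonneg by (intro sum_abs_weight_le_pos) (auto simp: f_def)
    also have "(\<Sum>T\<in>nsets V t. max 0 (f T)) = (\<Sum>T\<in>F. f T)"
      unfolding F_def by (intro sum.mono_neutral_cong_right) auto
    also have "\<dots> \<le> (\<Sum>T\<in>F. real m * w X0)"
    proof (rule sum_mono)
      fix T assume "T \<in> F"
      then have T: "T \<in> nsets V t" by (simp add: F_def)
      have "f T \<le> (\<Sum>X\<in>nsets T k. w X0)"
        unfolding f_def using sub[OF T] max by (intro sum_mono) blast
      then show "f T \<le> real m * w X0" using cardT[OF T] by simp
    qed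
    also have "\<dots> = real (card F) * (real m * w X0)" by simp
    also have "\<dots> \<le> real D * (real m * w X0)"
      using FD w0 by (intro mult_right_mono) auto
    finally have "real D * (\<Sum>X\<in>nsets V k. \<bar>w X\<bar>) \<le> c * (real D * (real m * w X0))"
      using c0 by (simp add: mult_left_mono)
    also have "\<dots> = real D * (K * w X0)" by (simp add: K_def)
    finally have "real D * (\<Sum>X\<in>nsets V k. \<bar>w X\<bar>) \<le> real D * (K * w X0)" .
    then show ?thesis using D_pos by simp
  qed
  define Star where "Star = {T \<in> nsets V t. X0 \<subseteq> T}"
  have Star: "card Star = D" "finite Star"
    unfolding D_def Star_def using V X0 k by (auto intro: card_nsets_containing)
  define Bad where "Bad = {T \<in> Star. f T < 0}"
  \<comment> \<open>In a bad \<open>T\<close> the other weights must outweigh \<open>w X0\<close>.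
    Summed over \<open>Bad\<close>, each \<open>X \<noteq> X0\<close> occurs at most
    \<open>D1\<close> times, because \<open>T\<close> contains \<open>X0\<close> and a point of
    \<open>X\<close> outside it.\<close>
  have "real (card Bad) * w X0 \<le> real D1 * (\<Sum>X\<in>nsets V k. \<bar>w X\<bar>)"
  proof -
    have "real (card Bad) * w X0 \<le> (\<Sum>T\<in>Bad. \<Sum>X\<in>nsets T k - {X0}. \<bar>w X\<bar>)"
    proof (subst sum_constant[symmetric], rule sum_mono)
      fix T assume "T \<in> Bad"
      then have T: "T \<in> nsets V t" "X0 \<subseteq> T" "f T < 0" by (auto simp: Bad_def Star_def)
      have "X0 \<in> nsets T k" "finite (nsets T k)"
        using T X0 V by (auto simp: nsets_def)
      then have "f T = w X0 + (\<Sum>X\<in>nsets T k - {X0}. w X)"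
        unfolding f_def by (simp add: sum.remove)
      moreover have "- (\<Sum>X\<in>nsets T k - {X0}. w X) \<le> (\<Sum>X\<in>nsets T k - {X0}. \<bar>w X\<bar>)"
        unfolding sum_negf[symmetric] by (intro sum_mono) auto
      ultimately show "w X0 \<le> (\<Sum>X\<in>nsets T k - {X0}. \<bar>w X\<bar>)" using T by simp
    qed
    also have "\<dots> = (\<Sum>T\<in>Bad. \<Sum>X\<in>{X \<in> nsets V k - {X0}. X \<subseteq> T}. \<bar>w X\<bar>)"
      by (intro sum.cong) (auto simp: Bad_def Star_def nsets_def)
    also have "\<dots> = (\<Sum>X\<in>nsets V k - {X0}. \<Sum>T\<in>{T \<in> Bad. X \<subseteq> T}. \<bar>w X\<bar>)"
      by (intro sum.swap_restrict) (auto simp: Bad_def Star)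
    also have "\<dots> \<le> (\<Sum>X\<in>nsets V k - {X0}. real D1 * \<bar>w X\<bar>)"
    proof (rule sum_mono)
      fix X assume X: "X \<in> nsets V k - {X0}"
      then have "\<not> X \<subseteq> X0" using X0 card_subset_eq[of X0 X] by (auto simp: nsets_def)
      then obtain x where x: "x \<in> X" "x \<notin> X0" by blast
      have "card {T \<in> Bad. X \<subseteq> T} \<le> card {T \<in> nsets V t. X0 \<subseteq> T \<and> x \<in> T}"
        using x by (intro card_mono) (auto simp: Bad_def Star_def)
      also have "\<dots> = D1"
        unfolding D1_def using x X X0 V k
        by (intro card_nsets_containing_insert) (auto simp: nsets_def)
      finally show "(\<Sum>T\<in>{T \<in> Bad. X \<subseteq> T}. \<bar>w X\<bar>) \<le> real D1 * \<bar>w X\<bar>"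
        by (simp add: mult_right_mono)
    qed
    also have "\<dots> \<le> (\<Sum>X\<in>nsets V k. real D1 * \<bar>w X\<bar>)"
      by (intro sum_mono2) auto
    finally show ?thesis by (simp add: sum_distrib_left)
  qed
  also have "\<dots> \<le> real D1 * (K * w X0)" using l1 by (intro mult_left_mono) auto
  finally have "real (card Bad) * w X0 \<le> (real D1 * K) * w X0" by (simp add: mult.assoc)
  then have Bad_le: "real (card Bad) \<le> real D1 * K" using w0 by simp
  have part: "card Star = card (F \<inter> Star) + card Bad" "card F = card (F \<inter> Star) + card (F - Star)"
  proof -
    have "Star = (F \<inter> Star) \<union> Bad" "(F \<inter> Star) \<inter> Bad = {}"
      by (auto simp: F_def Bad_def Star_def)
    then show "card Star = card (F \<inter> Star) + card Bad"
      using Star by (metis card_Un_disjoint finite_Un)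
    have "finite F" by (simp add: F_def)
    then show "card F = card (F \<inter> Star) + card (F - Star)" by (rule card_Int_Diff)
  qed
  \<comment> \<open>\<open>F\<close> misses exactly \<open>Bad\<close> within \<open>Star\<close>,
    and \<open>card F < D = card Star\<close>. So \<open>Bad\<close> is nonempty, which supplies
    \<open>T0\<close>, and its bound carries over to \<open>F - Star\<close>.\<close>
  then have FS: "card (F - Star) < card Bad" using FD Star by linarith
  then have "Bad \<noteq> {}" by auto
  then obtain T0 where T0: "T0 \<in> nsets V t" "X0 \<subseteq> T0" "f T0 < 0"
    by (auto simp: Bad_def Star_def)
  \<comment> \<open>Discarding the subsets of \<open>T0\<close> keeps the total positive, while the \<open>t\<close>-sets that share
    fewer than \<open>k\<close> points with \<open>T0\<close> keep their sums and avoid \<open>X0\<close>.\<close>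
  define w' where "w' = (\<lambda>X. if X \<subseteq> T0 then 0 else w X)"
  define f' where "f' = (\<lambda>T. \<Sum>X\<in>nsets T k. w' X)"
  define S where "S = (\<Sum>X\<in>nsets V k. \<bar>w' X\<bar>)"
  \<comment> \<open>The total grows by \<open>- f T0 > 0\<close>; strict positivity yields
    \<open>S > 0\<close>, so that \<open>S\<close> can be cancelled at the end.\<close>
  have "f' V = f V - f T0"
  proof -
    have "f V = (\<Sum>X\<in>nsets V k - nsets T0 k. w X) + f T0"
      unfolding f_def using sub[OF T0(1)] by (intro sum.subset_diff) auto
    moreover have "f' V = (\<Sum>X\<in>nsets V k - nsets T0 k. w X)"
      unfolding f'_def w'_def
      by (intro sum.mono_neutral_cong_right fin) (auto simp: nsets_def)
    ultimately show ?thesis by simp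
  qed
  then have f'_pos: "f' V > 0" using nonneg T0 by simp
  also have "f' V \<le> S" unfolding f'_def S_def by (intro sum_mono) auto
  finally have S_pos: "S > 0" .
  define R where "R = {T \<in> nsets V t. k \<le> card (T \<inter> T0)}"
  \<comment> \<open>Only \<open>X\<close> not inside \<open>T0\<close> has weight. Such an
    \<open>X\<close> meets \<open>T0\<close> in fewer than \<open>k\<close> points, so a
    \<open>T\<close> in \<open>R\<close> containing \<open>X\<close> has a further point in
    \<open>T0 - X\<close>: at most \<open>t\<close> choices, each with \<open>D1\<close>
    sets.\<close>
  have pos_R: "(\<Sum>T\<in>R. max 0 (f' T)) \<le> real t * real D1 * S"
  proof -
    have "(\<Sum>T\<in>R. max 0 (f' T)) \<le> (\<Sum>T\<in>R. \<Sum>X\<in>{X \<in> nsets V k. X \<subseteq> T}. \<bar>w' X\<bar>)"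
    proof (rule sum_mono)
      fix T assume "T \<in> R"
      then have "nsets T k = {X \<in> nsets V k. X \<subseteq> T}" by (auto simp: R_def nsets_def)
      moreover have "f' T \<le> (\<Sum>X\<in>nsets T k. \<bar>w' X\<bar>)" unfolding f'_def by (intro sum_mono) auto
      ultimately show "max 0 (f' T) \<le> (\<Sum>X\<in>{X \<in> nsets V k. X \<subseteq> T}. \<bar>w' X\<bar>)"
        by (simp add: sum_nonneg)
    qed
    also have "\<dots> = (\<Sum>X\<in>nsets V k. \<Sum>T\<in>{T \<in> R. X \<subseteq> T}. \<bar>w' X\<bar>)"
      by (intro sum.swap_restrict) (auto simp: R_def)
    also have "\<dots> \<le> (\<Sum>X\<in>nsets V k. real t * real D1 * \<bar>w' X\<bar>)"
    proof (rule sum_mono)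
      fix X assume X: "X \<in> nsets V k"
      show "(\<Sum>T\<in>{T \<in> R. X \<subseteq> T}. \<bar>w' X\<bar>) \<le> real t * real D1 * \<bar>w' X\<bar>"
      proof (cases "X \<subseteq> T0")
        case True
        then show ?thesis by (simp add: w'_def)
      next
        case False
        have X': "finite X" "card X = k" "X \<subseteq> V" using X by (auto simp: nsets_def)
        have T0': "finite T0" "card T0 = t" "T0 \<subseteq> V" using T0 by (auto simp: nsets_def)
        have "{T \<in> R. X \<subseteq> T} \<subseteq> (\<Union>x\<in>T0 - X. {T \<in> nsets V t. X \<subseteq> T \<and> x \<in> T})"
        proof
          fix T assume T: "T \<in> {T \<in> R. X \<subseteq> T}"
          have "X \<inter> T0 \<subset> X" using False by blast
          then have "card (X \<inter> T0) < k" using X' psubset_card_mono by blast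
          also have "k \<le> card (T \<inter> T0)" using T by (simp add: R_def)
          finally have "\<not> T \<inter> T0 \<subseteq> X \<inter> T0"
            using X' card_mono[of "X \<inter> T0" "T \<inter> T0"] by auto
          then show "T \<in> (\<Union>x\<in>T0 - X. {T \<in> nsets V t. X \<subseteq> T \<and> x \<in> T})"
            using T by (auto simp: R_def)
        qed
        then have "card {T \<in> R. X \<subseteq> T} \<le> card (\<Union>x\<in>T0 - X. {T \<in> nsets V t. X \<subseteq> T \<and> x \<in> T})"
          using T0' by (intro card_mono) auto
        also have "\<dots> \<le> (\<Sum>x\<in>T0 - X. card {T \<in> nsets V t. X \<subseteq> T \<and> x \<in> T})"
          using T0' by (intro card_UN_le) auto
        also have "\<dots> = (\<Sum>x\<in>T0 - X. D1)"
          unfolding D1_def using T0' X V k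
          by (intro sum.cong refl card_nsets_containing_insert) auto
        also have "\<dots> \<le> t * D1"
          using T0' card_mono[of T0 "T0 - X"] by (simp add: mult_right_mono)
        finally have "real (card {T \<in> R. X \<subseteq> T}) \<le> real t * real D1"
          by (metis of_nat_le_iff of_nat_mult)
        then show ?thesis by (simp add: mult_right_mono)
      qed
    qed
    finally show ?thesis by (simp add: S_def sum_distrib_left)
  qed
  \<comment> \<open>Outside \<open>R\<close> positive sums occur only in \<open>F - Star\<close>,
    which has fewer than \<open>card Bad\<close> members; each sum is at most
    \<open>S\<close>.\<close>
  have pos_nR: "(\<Sum>T\<in>nsets V t - R. max 0 (f' T)) \<le> real D1 * K * S"
  proof -
    have f'f: "f' T = f T" and nStar: "T \<notin> Star" if "T \<in> nsets V t - R" for T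
    proof -
      have lt: "card (T \<inter> T0) < k" using that by (auto simp: R_def)
      have no: "\<not> X \<subseteq> T0" if "X \<subseteq> T" "card X = k" for X
      proof
        assume "X \<subseteq> T0"
        then have "card X \<le> card (T \<inter> T0)"
          using that T0 by (intro card_mono) (auto simp: nsets_def)
        then show False using lt that by simp
      qed
      then show "f' T = f T"
        unfolding f'_def f_def w'_def by (intro sum.cong) (auto simp: nsets_def)
      show "T \<notin> Star" using no[of X0] X0 T0 by (auto simp: Star_def nsets_def)
    qed
    have "(\<Sum>T\<in>nsets V t - R. max 0 (f' T)) = (\<Sum>T\<in>(nsets V t - R) \<inter> F. max 0 (f' T))"
      by (intro sum.mono_neutral_right) (auto simp: f'f F_def)
    also have "\<dots> \<le> (\<Sum>T\<in>(nsets V t - R) \<inter> F. S)"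
    proof (rule sum_mono)
      fix T assume "T \<in> (nsets V t - R) \<inter> F"
      then have T: "T \<in> nsets V t" by simp
      have "f' T \<le> (\<Sum>X\<in>nsets T k. \<bar>w' X\<bar>)" unfolding f'_def by (intro sum_mono) auto
      also have "\<dots> \<le> S" unfolding S_def using sub[OF T] by (intro sum_mono2) auto
      finally show "max 0 (f' T) \<le> S" using S_pos by simp
    qed
    also have "\<dots> = real (card ((nsets V t - R) \<inter> F)) * S" by simp
    also have "\<dots> \<le> real (card (F - Star)) * S"
      using S_pos nStar by (intro mult_right_mono of_nat_mono card_mono) (auto simp: F_def)
    also have "\<dots> \<le> real D1 * K * S"
      using FS Bad_le S_pos by (intro mult_right_mono) auto
    finally show ?thesis .
  qed
  have "real D * S \<le> c * (\<Sum>T\<in>nsets V t. max 0 (f' T))"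
    unfolding D_def c_def m_def f'_def S_def
    using V k f'_pos by (intro sum_abs_weight_le_pos) (auto simp: f'_def)
  also have "(\<Sum>T\<in>nsets V t. max 0 (f' T)) = (\<Sum>T\<in>nsets V t - R. max 0 (f' T)) + (\<Sum>T\<in>R. max 0 (f' T))"
    by (intro sum.subset_diff) (auto simp: R_def)
  also have "c * \<dots> \<le> c * (real D1 * K * S + real t * real D1 * S)"
    using pos_R pos_nR c0 by (intro mult_left_mono add_mono)
  also have "\<dots> = (c * (K + real t) * real D1) * S" by (simp add: algebra_simps)
  finally have DD: "real D \<le> c * (K + real t) * real D1" using S_pos by simp
  have "real (n - k) * real D \<le> real (n - k) * (c * (K + real t) * real D1)"
    using DD by (intro mult_left_mono) auto
  also have "\<dots> = c * (K + real t) * real ((n - k) * D1)" by simp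
  also have "\<dots> = (c * (K + real t) * real (t - k)) * real D" unfolding D1 by simp
  finally have "real (n - k) \<le> c * (K + real t) * real (t - k)" using D_pos by simp
  then show False
    using n k unfolding c_def K_def m_def by (simp add: power2_eq_square mult.assoc of_nat_diff)
qed

section \<open>Numerical estimates and the absolute constant\<close>

lemma two_power_le_two_fact: "2 ^ k \<le> 2 * (fact k :: nat)"
proof (induction k)
  case (Suc k)
  show ?case
  proof (cases k)
    case (Suc j)
    have "2 ^ Suc k \<le> 2 * (2 * fact k :: nat)" using Suc.IH by simp
    also have "\<dots> \<le> Suc k * (2 * fact k)" by (intro mult_right_mono) (auto simp: Suc)
    finally show ?thesis by (simp add: algebra_simps)
  qed simp
qed simp

text \<open>The factorial in the denominator of \<open>t choose k\<close> absorbs the power of two,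
  which keeps the final constant independent of \<open>k\<close>.\<close>

lemma two_power_choose_le: "2 ^ (k + 1) * real (t choose k) \<le> 4 * real t ^ k"
proof -
  have "2 ^ k * (t choose k) \<le> 2 * fact k * (t choose k)"
    by (intro mult_right_mono two_power_le_two_fact) auto
  also have "\<dots> \<le> 2 * t ^ k" using binomial_fact_pow[of t k] by (simp add: mult_ac)
  finally have "real (2 ^ k * (t choose k)) \<le> real (2 * t ^ k)" by (simp only: of_nat_le_iff)
  then show ?thesis by (simp add: mult_ac)
qed

theorem theorem1p5:
  shows "\<exists>C::real. C > 0 \<and>
    (\<forall>(k::nat) (t::nat) (n::nat) (w :: nat set \<Rightarrow> real).
       0 < k \<longrightarrow> k < t \<longrightarrow>
       real n > C * real t ^ (3 * k + 3) \<longrightarrow>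
       (\<Sum>X\<in>nsets {1..n} k. w X) \<ge> 0 \<longrightarrow>
       card {T \<in> nsets {1..n} t. (\<Sum>X\<in>nsets T k. w X) \<ge> 0} \<ge> (n - k) choose (t - k))"
\<comment> \<open>21 = 16 + 4 + 1: the product of the estimates gives 16 and 4, and the summand
  \<open>k\<close> gives 1.\<close>
proof (intro exI[of _ 21] conjI allI impI)
  fix k t n :: nat and w :: "nat set \<Rightarrow> real"
  assume k: "0 < k" "k < t" and n: "real n > 21 * real t ^ (3 * k + 3)"
    and w: "(\<Sum>X\<in>nsets {1..n} k. w X) \<ge> 0"
  define r m where "r = real t" and "m = real (t choose k)"
  have r: "r \<ge> 1" using k by (simp add: r_def)
  have pow: "r ^ a \<le> r ^ (3 * k + 3)" if "a \<le> 3 * k + 3" for a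
    using that r by (rule power_increasing)
  have kr: "real k \<le> r" "r \<le> r ^ (3 * k + 3)" using pow[of 1] k by (simp_all add: r_def)
  have m: "0 \<le> m" "2 ^ (k + 1) * m \<le> 4 * r ^ k"
    unfolding m_def r_def by (simp, rule two_power_choose_le)
  have "m \<le> r ^ k"
    unfolding m_def r_def using binomial_le_pow[of k t] k by (simp flip: of_nat_power)
  \<comment> \<open>There is one power of two for two factors \<open>m\<close>, so one factor
    absorbs it and the other is bounded by \<open>r ^ k\<close> alone.\<close>
  then have "2 ^ (k + 1) * m * m \<le> 4 * r ^ k * r ^ k"
    using m(1) r by (intro mult_mono[OF m(2)]) auto
  then have "2 ^ (k + 1) * m\<^sup>2 \<le> 4 * r ^ (2 * k)"
    by (simp only: power2_eq_square mult.assoc power_add mult_2)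
  then have inner: "2 ^ (k + 1) * m\<^sup>2 + r \<le> 4 * r ^ (2 * k) + r"
    by (rule add_right_mono)
  have "2 ^ (k + 1) * m * (2 ^ (k + 1) * m\<^sup>2 + r) * real (t - k)
      \<le> 4 * r ^ k * (4 * r ^ (2 * k) + r) * r"
    by (rule mult_mono[OF mult_mono[OF m(2) inner]]) (use m(1) r k in \<open>auto simp: r_def\<close>)
  also have "\<dots> = 16 * r ^ (3 * k + 1) + 4 * r ^ (k + 2)"
  proof -
    have "2 * k = k + k" "3 * k = k + k + k" by simp_all
    then have "r ^ (2 * k) = r ^ k * r ^ k" "r ^ (3 * k + 1) = r ^ k * r ^ k * r ^ k * r"
      "r ^ (k + 2) = r ^ k * r * r"
      by (simp_all only: power_add power_one_right power2_eq_square mult.assoc)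
    then show ?thesis by (simp only:) (simp add: algebra_simps)
  qed
  also have "\<dots> \<le> 20 * r ^ (3 * k + 3)"
    using pow[of "3 * k + 1"] pow[of "k + 2"] by simp
  finally have "real k + 2 ^ (k + 1) * m * (2 ^ (k + 1) * m\<^sup>2 + r) * real (t - k)
      \<le> 21 * r ^ (3 * k + 3)"
    using kr by linarith
  also have "\<dots> < real n" using n by (simp add: r_def)
  finally have big: "real k + 2 ^ (k + 1) * real (t choose k) *
      (2 ^ (k + 1) * real (t choose k) ^ 2 + real t) * real (t - k) < real n"
    by (simp add: m_def r_def)
  have "real t + real k < real n" using kr n unfolding r_def by linarith
  then have "t + k \<le> n" by linarith
  then show "(n - k) choose (t - k) \<le> card {T \<in> nsets {1..n} t. (\<Sum>X\<in>nsets T k. w X) \<ge> 0}"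
    using k w big by (intro card_nonneg_sums_ge) auto
qed simp

end
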